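(* Given a Motzkin path $p$, let $p_{\mathsf{min}}$ be the resulting Motzkin path of $p$ under the shape algorithm. Then the Richardson tableaux corresponding to $p$ and to $p_{\mathsf{min}}$ have the same shape.
   Context: Motzkin paths. A Motzkin path of length $n$ is a lattice path from $(0,0)$ to $(n,0)$ with steps $U=(1,1)$, $H=(1,0)$, $D=(1,-1)$ staying weakly above the $x$-axis; $\mathcal{M}(n)$ is the set of these. $\oplus$ denotes concatenation of paths. A block is either a single $H$ step on its base line, or a sequence of steps starting with a $U$ step from the base line and ending with the first $D$ step returning to the base line afterwards (the base line is the $x$-axis unless stated otherwise). The unit Motzkin path $u^{(j)}$ of length $j\ge1$ is $U^{j/2}D^{j/2}$ if $j$ is even and $U^{(j-1)/2}HD^{(j-1)/2}$ if $j$ is odd. For a path $p$ with maximal height $y(p)$ (measured relative to its base line, or equivalently in absolute coordinates when comparing blocks on the same base line), $\mathsf{ht}(p)=y(p)+\frac12$ if $p$ has an $H$ step at the maximal height, and $\mathsf{ht}(p)=y(p)$ otherwise. Shape algorithm. Given $p\in\mathcal{M}(n)$, set $\overline p=p$. (1) Let $\overline p=p_1\oplus\cdots\oplus p_s$ be the decomposition into blocks. If all $p_i$ are unit Motzkin paths go to (3), else go to (2). (2) Let $i$ be least such that $p_i$ is not a unit Motzkin path. Let $M$ be the greatest integer such that $p_i=U^M\oplus q_1\oplus\cdots\oplus q_k\oplus D^M$ with each $q_j$ a block with base line $y=M$. Let $t$ be the least index for which $\mathsf{ht}(q_t)$ is maximal among $\mathsf{ht}(q_1),\dots,\mathsf{ht}(q_k)$.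 Replace $p_i$ in $\overline p$ by $p_i'=q_1\oplus\cdots\oplus q_{t-1}\oplus U^M\oplus q_t\oplus D^M\oplus q_{t+1}\oplus\cdots\oplus q_k$ and return to (1). (3) Set $p_{\mathsf{min}}=\overline p$. (The algorithm terminates.) Corresponding tableau. To a Motzkin path $p\in\mathcal{M}(n)$ corresponds the unique noncrossing involution $\pi$ of $\{1,\dots,n\}$ (an involution with no two 2-cycles $(a,b)$, $(c,d)$ satisfying $a<c<b<d$) such that step $i$ of $p$ is $U$ (resp. $D$) if $i$ is the smaller (resp. larger) element of a 2-cycle of $\pi$, and $H$ if $i$ is a fixed point. The Richardson tableau corresponding to $p$ is the insertion tableau of $\pi=\pi_1\cdots\pi_n$ under the Robinson--Schensted row-insertion algorithm. (It is known, by a theorem of Guo, that this gives a bijection from $\mathcal{M}(n)$ onto the Richardson tableaux of size $n$, i.e. the standard Young tableaux $T$ such that for each $j$ lying in row $r_j\ge2$ of $T$, the largest entry less than $j$ in row $r_j-1$ exceeds every entry less than $j$ in rows $\geq r_j$.) *)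

theory Defs
  imports Complex_Main "HOL-Combinatorics.Permutations" "HOL-Library.While_Combinator"
begin

datatype step = U | H | D

fun rise :: "step \<Rightarrow> int" where
  "rise U = 1"
| "rise H = 0"
| "rise D = -1"

definition height :: "step list \<Rightarrow> int" where
  "height p = (\<Sum>s\<leftarrow>p. rise s)"

definition motzkin_paths :: "nat \<Rightarrow> step list set" where
  "motzkin_paths n =
    {p. length p = n \<and> height p = 0 \<and> (\<forall>k\<le>n. 0 \<le> height (take k p))}"

text \<open>
  A path is the list of its steps, so concatenation of paths is list append. A segment of a path
  is also just a list of steps: its starting point is taken to be at height 0, i.e. heights inside
  a block are measured relative to the base line of the block.
\<close>

definition is_block :: "step list \<Rightarrow> bool" where
  "is_block b \<longleftrightarrow>
    b = [H] \<or>
    (b \<noteq> [] \<and> hd b = U \<and> last b = D \<and> height b = 0 \<and>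
      (\<forall>k. 0 < k \<and> k < length b \<longrightarrow> height (take k b) \<noteq> 0))"

definition blocks :: "step list \<Rightarrow> step list list" where
  "blocks p = (THE bs. (\<forall>b\<in>set bs. is_block b) \<and> concat bs = p)"

definition unit_path :: "nat \<Rightarrow> step list" where
  "unit_path j =
    (if even j then replicate (j div 2) U @ replicate (j div 2) D
     else replicate ((j - 1) div 2) U @ [H] @ replicate ((j - 1) div 2) D)"

definition is_unit_path :: "step list \<Rightarrow> bool" where
  "is_unit_path p \<longleftrightarrow> (\<exists>j\<ge>1. p = unit_path j)"

definition max_height :: "step list \<Rightarrow> int" where
  "max_height p = Max ((\<lambda>k. height (take k p)) ` {0..length p})"

definition ht :: "step list \<Rightarrow> rat" where
  "ht p =
    (if \<exists>k<length p. p ! k = H \<and> height (take k p) = max_height p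
     then of_int (max_height p) + 1 / 2
     else of_int (max_height p))"

definition all_unit :: "step list \<Rightarrow> bool" where
  "all_unit p \<longleftrightarrow> (\<forall>b\<in>set (blocks p). is_unit_path b)"

definition block_step :: "step list \<Rightarrow> step list" where
  "block_step b =
    (let M = (GREATEST m. \<exists>qs. (\<forall>q\<in>set qs. is_block q) \<and>
                b = replicate m U @ concat qs @ replicate m D);
         qs = (THE qs. (\<forall>q\<in>set qs. is_block q) \<and>
                b = replicate M U @ concat qs @ replicate M D);
         t = (LEAST t. t < length qs \<and> (\<forall>j<length qs. ht (qs ! j) \<le> ht (qs ! t)))
     in concat (take t qs) @ replicate M U @ qs ! t @ replicate M D @ concat (drop (Suc t) qs))"

definition shape_step :: "step list \<Rightarrow> step list" where
  "shape_step p =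
    (let bs = blocks p;
         i = (LEAST i. i < length bs \<and> \<not> is_unit_path (bs ! i))
     in concat (take i bs) @ block_step (bs ! i) @ concat (drop (Suc i) bs))"

text \<open>
  \<open>while\<close> returns an unspecified value on a diverging loop, so any fact about \<open>p_min p\<close>
  includes the termination of the algorithm started at \<open>p\<close>.
\<close>

definition p_min :: "step list \<Rightarrow> step list" where
  "p_min p = while (\<lambda>q. \<not> all_unit q) shape_step p"

definition noncrossing_involution :: "nat \<Rightarrow> (nat \<Rightarrow> nat) \<Rightarrow> bool" where
  "noncrossing_involution n \<pi> \<longleftrightarrow>
    \<pi> permutes {1..n} \<and> (\<forall>i. \<pi> (\<pi> i) = i) \<and>
    \<not> (\<exists>a b c d. \<pi> a = b \<and> \<pi> c = d \<and> a < c \<and> c < b \<and> b < d)"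

definition path_involution :: "step list \<Rightarrow> nat \<Rightarrow> nat" where
  "path_involution p =
    (THE \<pi>. noncrossing_involution (length p) \<pi> \<and>
      (\<forall>i\<in>{1..length p}.
        p ! (i - 1) = (if i < \<pi> i then U else if \<pi> i < i then D else H)))"

text \<open>
  A tableau is the list of its rows, from the top.
  \<open>row_insert\<close> also returns the bumped entry, if any.
\<close>

fun row_insert :: "nat \<Rightarrow> nat list \<Rightarrow> nat list \<times> nat option" where
  "row_insert x [] = ([x], None)"
| "row_insert x (y # ys) =
    (if x < y then (x # ys, Some y)
     else (let (ys', z) = row_insert x ys in (y # ys', z)))"

fun tableau_insert :: "nat \<Rightarrow> nat list list \<Rightarrow> nat list list" where
  "tableau_insert x [] = [[x]]"
| "tableau_insert x (r # rs) =
    (case row_insert x r of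
       (r', None) \<Rightarrow> r' # rs
     | (r', Some y) \<Rightarrow> r' # tableau_insert y rs)"

definition insertion_tableau :: "nat list \<Rightarrow> nat list list" where
  "insertion_tableau w = fold tableau_insert w []"

definition richardson_tableau :: "step list \<Rightarrow> nat list list" where
  "richardson_tableau p = insertion_tableau (map (path_involution p) [1..<Suc (length p)])"

definition shape :: "nat list list \<Rightarrow> nat list" where
  "shape T = map length T"

end

theory Submission imports Defs begin

text \<open>
  The shape of a path is determined by its block structure. Concatenation places the second
  insertion tableau to the right of the first, so shapes add row by row. Wrapping a path in an
  arc \<open>U \<dots> D\<close> puts a maximum in front of the word and a minimum at its end, which
  makes the first column longer by two. Hence the number of rows of the shape of \<open>p\<close> is twice
  \<open>ht p\<close>, and moving the \<open>M\<close> outer arcs of a block onto its highest inner block extends the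
  first column of the total shape by \<open>2 M\<close> either way. Each round replaces a block by at least
  two, so the algorithm terminates.
\<close>

section \<open>Motzkin paths and their blocks\<close>

text \<open>The length-free form of membership in \<open>motzkin_paths\<close>. The prefix length
  \<open>k\<close> may run unbounded, as \<open>take k p\<close> is \<open>p\<close> itself beyond
  the end.\<close>

definition motzkin :: "step list \<Rightarrow> bool" where
  "motzkin p \<longleftrightarrow> height p = 0 \<and> (\<forall>k. 0 \<le> height (take k p))"

lemma height_Nil [simp]: "height [] = 0"
  by (simp add: height_def)

lemma height_Cons [simp]: "height (s # p) = rise s + height p"
  by (simp add: height_def)

lemma height_append [simp]: "height (p @ q) = height p + height q"
  by (simp add: height_def)

lemma motzkin_iff: "motzkin p \<longleftrightarrow> p \<in> motzkin_paths (length p)"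
proof -
  have "0 \<le> height (take k p)"
    if "height p = 0" "\<forall>k\<le>length p. 0 \<le> height (take k p)" for k
    using that by (cases "k \<le> length p") auto
  then show ?thesis
    by (auto simp: motzkin_def motzkin_paths_def)
qed

lemma motzkin_Nil [simp]: "motzkin []"
  by (simp add: motzkin_def)

lemma motzkin_H [simp]: "motzkin [H]"
  by (auto simp: motzkin_def take_Cons split: nat.splits)

lemma motzkin_append: "motzkin p \<Longrightarrow> motzkin q \<Longrightarrow> motzkin (p @ q)"
  by (simp add: motzkin_def)

lemma motzkin_wrap:
  assumes "motzkin q"
  shows "motzkin (U # q @ [D])"
proof -
  have "0 \<le> height (take k (U # q @ [D]))" for k
  proof (cases k)
    case (Suc j)
    show ?thesis
    proof (cases "j \<le> length q")
      case True
      then show ?thesis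
        using assms Suc by (simp add: motzkin_def add_nonneg_nonneg)
    next
      case False
      then show ?thesis
        using assms Suc by (simp add: motzkin_def take_Cons')
    qed
  qed simp
  then show ?thesis
    using assms by (simp add: motzkin_def)
qed

lemma motzkin_wraps:
  assumes "motzkin q"
  shows "motzkin (replicate m U @ q @ replicate m D)"
proof (induction m)
  case (Suc m)
  have "replicate (Suc m) U @ q @ replicate (Suc m) D
      = U # (replicate m U @ q @ replicate m D) @ [D]"
    by (simp add: replicate_append_same)
  then show ?case
    using motzkin_wrap[OF Suc] by presburger
qed (use assms in simp)

text \<open>The shortest prefix of negative height must end with a \<open>D\<close> leaving level 0,
  as a step descends by at most one. After an initial \<open>U\<close> this \<open>D\<close> is the
  matching step that closes the arc.\<close>

lemma first_descent:
  assumes "height r < 0"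
  obtains q s where "r = q @ D # s" "height q = 0" "\<forall>k. 0 \<le> height (take k q)"
proof -
  let ?P = "\<lambda>k. height (take k r) < 0"
  define k where "k = (LEAST k. ?P k)"
  have "?P (length r)"
    using assms by simp
  then have k: "?P k" and le: "k \<le> length r"
    unfolding k_def by (rule LeastI, rule Least_le)
  have least: "\<not> ?P j" if "j < k" for j
    using that unfolding k_def by (rule not_less_Least)
  obtain j where j: "k = Suc j"
    using k by (cases k) auto
  then have jl: "j < length r"
    using le by simp
  have nonneg: "0 \<le> height (take i r)" if "i \<le> j" for i
    using least[of i] that j by simp
  have "height (take k r) = height (take j r) + rise (r ! j)"
    using jl by (simp add: j take_Suc_conv_app_nth)
  then have "r ! j = D \<and> height (take j r) = 0"
    using k nonneg[of j] by (cases "r ! j") auto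
  moreover have "r = take j r @ r ! j # drop (Suc j) r"
    using jl by (simp add: id_take_nth_drop)
  moreover have "0 \<le> height (take i (take j r))" for i
    using nonneg[of "min i j"] by simp
  ultimately show ?thesis
    using that by metis
qed

section \<open>Decomposition of paths into blocks\<close>

lemma is_block_height [simp]: "is_block b \<Longrightarrow> height b = 0"
  by (auto simp: is_block_def)

lemma is_block_nonempty [simp]: "is_block b \<Longrightarrow> b \<noteq> []"
  unfolding is_block_def by auto

lemma is_block_prime:
  "is_block b \<Longrightarrow> 0 < k \<Longrightarrow> k < length b \<Longrightarrow> height (take k b) \<noteq> 0"
  unfolding is_block_def by auto

lemma is_block_wrap:
  assumes "motzkin q"
  shows "is_block (U # q @ [D])"
proof -
  have "height (take k (U # q @ [D])) \<noteq> 0" if k: "0 < k" "k < length (U # q @ [D])" for k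
  proof -
    obtain j where j: "k = Suc j" "j \<le> length q"
      using k by (cases k) auto
    have "0 \<le> height (take j q)"
      using assms by (simp add: motzkin_def)
    then show ?thesis
      using j by simp
  qed
  then show ?thesis
    using assms unfolding is_block_def motzkin_def by simp
qed

lemma is_block_H [simp]: "is_block [H]"
  unfolding is_block_def by simp

text \<open>Behind the opening \<open>U\<close>, the first descent closes the arc. Any steps left
  after it would make this an interior return to level 0, which a block forbids.\<close>

lemma is_block_cases:
  assumes "is_block b"
  obtains "b = [H]" | q where "motzkin q" "b = U # q @ [D]"
proof (cases "b = [H]")
  case False
  then have b: "b \<noteq> []" "hd b = U" "last b = D" "height b = 0"
    using assms unfolding is_block_def by auto
  then obtain r where r: "b = U # r"
    by (cases b) auto
  then have "height r < 0"
    using b by simp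
  then obtain q s where q: "r = q @ D # s" "height q = 0" "\<forall>k. 0 \<le> height (take k q)"
    by (rule first_descent)
  have "s = []"
  proof (rule ccontr)
    assume "s \<noteq> []"
    then have "height (take (length (U # q @ [D])) b) \<noteq> 0"
      by (intro is_block_prime[OF assms]) (auto simp: r q)
    then show False
      by (simp add: r q)
  qed
  then show ?thesis
    using that(2)[of q] q r by (simp add: motzkin_def)
qed (use that in blast)

lemma is_block_motzkin: "is_block b \<Longrightarrow> motzkin b"
  by (erule is_block_cases) (simp_all add: motzkin_wrap[simplified])

lemma motzkin_concat: "\<forall>b\<in>set bs. is_block b \<Longrightarrow> motzkin (concat bs)"
  by (induction bs) (auto intro: motzkin_append is_block_motzkin)

text \<open>Induction on the length: the first block, \<open>[H]\<close> or the arc found by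
  \<open>first_descent\<close>, is split off. It has height 0, so prefixes of the remainder have the
  heights of prefixes of \<open>p\<close>.\<close>

lemma motzkin_imp_concat:
  assumes "motzkin p"
  shows "\<exists>bs. (\<forall>b\<in>set bs. is_block b) \<and> concat bs = p"
  using assms
proof (induction p rule: length_induct)
  case (1 p)
  have p0: "height p = 0" "\<And>k. 0 \<le> height (take k p)"
    using "1.prems" by (simp_all add: motzkin_def)
  have step: ?case if b: "is_block b" and p: "p = b @ s" for b s
  proof -
    have "0 \<le> height (take k s)" for k
    proof -
      have "0 \<le> height (take (length b + k) p)"
        by (rule p0)
      then show ?thesis
        using b p by simp
    qed
    then have "motzkin s"
      using p0(1) b p by (simp add: motzkin_def)
    moreover have "length s < length p"
      using b p by simp
    ultimately obtain bs where "\<forall>b\<in>set bs. is_block b" "concat bs = s"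
      using "1.IH" by blast
    then show ?thesis
      using b p by (intro exI[of _ "b # bs"]) simp
  qed
  show ?case
  proof (cases p)
    case Nil
    then show ?thesis
      by (intro exI[of _ "[]"]) simp
  next
    case (Cons x r)
    show ?thesis
    proof (cases x)
      case H
      then show ?thesis
        using step[of "[H]" r] Cons by simp
    next
      case D
      have "0 \<le> height (take 1 p)"
        by (rule p0)
      then show ?thesis
        using D Cons by simp
    next
      case U
      then have "height r < 0"
        using p0(1) Cons by simp
      then obtain q s where q: "r = q @ D # s" "height q = 0" "\<forall>k. 0 \<le> height (take k q)"
        by (rule first_descent)
      then show ?thesis
        using step[of "U # q @ [D]" s] U Cons is_block_wrap[of q] by (simp add: motzkin_def)
    qed
  qed
qed

text \<open>Otherwise \<open>b\<close> would be a proper nonempty prefix of \<open>c\<close> ending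
  at level 0. Used in both directions, this makes the first blocks of two decompositions
  equal.\<close>

lemma block_prefix_length:
  assumes "is_block b" "is_block c" "b @ x = c @ y"
  shows "length c \<le> length b"
proof (rule ccontr)
  assume "\<not> ?thesis"
  moreover from this have "take (length b) c = b"
    using arg_cong[OF assms(3), of "take (length b)"] by simp
  ultimately show False
    using is_block_prime[of c "length b"] assms by simp
qed

lemma concat_blocks_inject:
  assumes "\<forall>b\<in>set bs. is_block b" "\<forall>b\<in>set cs. is_block b" "concat bs = concat cs"
  shows "bs = cs"
  using assms
proof (induction bs arbitrary: cs)
  case Nil
  show ?case
  proof (cases cs)
    case (Cons c cs')
    then have "is_block c" "c = []"
      using Nil.prems by simp_all
    then show ?thesis
      using is_block_nonempty by blast
  qed simp
next
  case (Cons b bs)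
  have "b \<noteq> []"
    using Cons.prems(1) by simp
  with Cons.prems obtain c cs' where cs: "cs = c # cs'"
    by (cases cs) auto
  have eq: "b @ concat bs = c @ concat cs'"
    using Cons.prems cs by simp
  have "length b = length c"
    using block_prefix_length[OF _ _ eq] block_prefix_length[OF _ _ eq[symmetric]] Cons.prems cs
    by (simp add: order.antisym)
  then have "b = c" "concat bs = concat cs'"
    using eq by simp_all
  then show ?case
    using Cons.IH[of cs'] Cons.prems(1,2) cs by simp
qed

lemma blocks_concat:
  assumes "\<forall>b\<in>set bs. is_block b"
  shows "blocks (concat bs) = bs"
  unfolding blocks_def
  by (rule the_equality) (use assms concat_blocks_inject in auto)

lemma motzkin_blocks:
  assumes "motzkin p"
  shows "\<forall>b\<in>set (blocks p). is_block b" "concat (blocks p) = p"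
  using motzkin_imp_concat[OF assms] blocks_concat by auto

text \<open>Bounds the number of blocks, which grows in each round of the algorithm.\<close>

lemma length_blocks_le:
  assumes "\<forall>b\<in>set bs. is_block b"
  shows "length bs \<le> length (concat bs)"
  using assms
proof (induction bs)
  case (Cons b bs)
  then have "1 \<le> length b" "length bs \<le> length (concat bs)"
    by (simp_all add: Suc_le_eq)
  then have "1 + length bs \<le> length b + length (concat bs)"
    by (rule add_mono)
  then show ?case
    by simp
qed simp

section \<open>The noncrossing involution of a path\<close>

text \<open>The predicate under the definite description of \<open>path_involution\<close>, named so
  that explicit involutions can be identified through uniqueness.\<close>

definition involution_of :: "step list \<Rightarrow> (nat \<Rightarrow> nat) \<Rightarrow> bool" where
  "involution_of p \<pi> \<longleftrightarrow> noncrossing_involution (length p) \<pi> \<and>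
    (\<forall>i\<in>{1..length p}. p ! (i - 1) = (if i < \<pi> i then U else if \<pi> i < i then D else H))"

lemma involution_ofD:
  assumes "involution_of p \<pi>"
  shows "\<pi> (\<pi> i) = i" "i \<notin> {1..length p} \<Longrightarrow> \<pi> i = i"
    "i \<in> {1..length p} \<Longrightarrow> \<pi> i \<in> {1..length p}"
    "\<pi> a = b \<Longrightarrow> \<pi> c = d \<Longrightarrow> a < c \<Longrightarrow> c < b \<Longrightarrow> \<not> b < d"
    "i \<in> {1..length p} \<Longrightarrow> p ! (i - 1) = (if i < \<pi> i then U else if \<pi> i < i then D else H)"
proof -
  have \<pi>: "\<pi> permutes {1..length p}"
    using assms unfolding involution_of_def noncrossing_involution_def by blast
  show "i \<notin> {1..length p} \<Longrightarrow> \<pi> i = i"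
    using permutes_not_in[OF \<pi>] .
  show "i \<in> {1..length p} \<Longrightarrow> \<pi> i \<in> {1..length p}"
    using permutes_in_image[OF \<pi>] by simp
qed (use assms in \<open>unfold involution_of_def noncrossing_involution_def, blast\<close>)+

lemma involution_ofI:
  assumes "\<And>i. \<pi> (\<pi> i) = i" "\<And>i. i \<notin> {1..length p} \<Longrightarrow> \<pi> i = i"
    "\<And>a c. a < c \<Longrightarrow> c < \<pi> a \<Longrightarrow> \<pi> a < \<pi> c \<Longrightarrow> False"
    "\<And>i. i \<in> {1..length p} \<Longrightarrow> p ! (i - 1) = (if i < \<pi> i then U else if \<pi> i < i then D else H)"
  shows "involution_of p \<pi>"
proof -
  have "\<pi> permutes {1..length p}"
    unfolding permutes_def using assms(1,2) by metis
  moreover have "\<not> (\<exists>a b c d. \<pi> a = b \<and> \<pi> c = d \<and> a < c \<and> c < b \<and> b < d)"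
    using assms(3) by blast
  ultimately show ?thesis
    unfolding involution_of_def noncrossing_involution_def using assms(1,4) by simp
qed

text \<open>
  At the first down step \<open>b\<close> where two such involutions differ, the larger of its two candidate
  partners is an up step that the other involution would have to match strictly before \<open>b\<close>,
  where the two agree.
\<close>

lemma involution_of_unique:
  assumes \<pi>: "involution_of p \<pi>" and \<sigma>: "involution_of p \<sigma>"
  shows "\<pi> = \<sigma>"
proof -
  have sgn: "(i < \<pi> i \<longleftrightarrow> i < \<sigma> i) \<and> (\<pi> i < i \<longleftrightarrow> \<sigma> i < i)" for i
  proof (cases "i \<in> {1..length p}")
    case True
    show ?thesis
      using involution_ofD(5)[OF \<pi> True] involution_ofD(5)[OF \<sigma> True]
      by (auto split: if_splits)
  next
    case False
    then show ?thesis
      using involution_ofD(2)[OF \<pi> False] involution_ofD(2)[OF \<sigma> False] by simp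
  qed
  \<comment> \<open>Stated for generic \<open>f\<close> and \<open>g\<close>, because both orders of
    the two candidate partners of \<open>b\<close> have to be refuted.\<close>
  have no: False
    if inv: "involution_of p f" "involution_of p g"
      and sg: "\<And>i. i < f i \<longleftrightarrow> i < g i" "f b < g b" "g b < b"
      and IH: "\<And>c. c < b \<Longrightarrow> f c < c \<Longrightarrow> f c = g c" for f g :: "nat \<Rightarrow> nat" and b
  proof -
    note f = involution_ofD[OF inv(1)] and g = involution_ofD[OF inv(2)]
    have up: "g b < f (g b)"
      using sg g(1)[of b] by metis
    have "\<not> b < f (g b)"
      using f(4)[of "f b" b "g b" "f (g b)"] f(1)[of b] sg by simp
    moreover have "f (g b) \<noteq> b"
      using f(1)[of "g b"] sg by auto
    ultimately have lt: "f (g b) < b"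
      by simp
    have "f (f (g b)) = g (f (g b))"
      using IH[OF lt] f(1)[of "g b"] up by simp
    then show False
      using f(1) g(1) lt by (metis less_irrefl)
  qed
  have down: "\<pi> b < b \<Longrightarrow> \<pi> b = \<sigma> b" for b
  proof (induction b rule: less_induct)
    case (less b)
    have sb: "\<sigma> b < b"
      using less sgn by blast
    have "\<not> \<pi> b < \<sigma> b"
      using no[OF \<pi> \<sigma>, of b] sgn sb less by blast
    moreover have "\<not> \<sigma> b < \<pi> b"
    proof
      assume lt: "\<sigma> b < \<pi> b"
      have "\<sigma> c = \<pi> c" if "c < b" "\<sigma> c < c" for c
        using less.IH[of c] that sgn[of c] by auto
      then show False
        using no[OF \<sigma> \<pi>, of b] sgn lt less.prems by blast
    qed
    ultimately show ?case
      by simp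
  qed
  show ?thesis
  proof
    fix i
    consider "\<pi> i < i" | "\<pi> i = i" | "i < \<pi> i"
      by linarith
    then show "\<pi> i = \<sigma> i"
    proof cases
      case 1
      then show ?thesis
        by (rule down)
    next
      case 2
      then show ?thesis
        using sgn[of i] by simp
    next
      case 3
      \<comment> \<open>The partner of an up step is a down step, where the two involutions already
        agree.\<close>
      then have "\<pi> (\<pi> i) < \<pi> i"
        using involution_ofD(1)[OF \<pi>] by simp
      then show ?thesis
        using down involution_ofD(1)[OF \<pi>] involution_ofD(1)[OF \<sigma>] by metis
    qed
  qed
qed

lemma path_involution_eq: "involution_of p \<pi> \<Longrightarrow> path_involution p = \<pi>"
  unfolding path_involution_def involution_of_def[symmetric]
  by (rule the_equality) (auto dest: involution_of_unique)

lemma involution_of_Nil: "involution_of [] id"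
  by (rule involution_ofI) auto

lemma involution_of_H: "involution_of [H] id"
  by (rule involution_ofI) auto

text \<open>Each half is mapped into itself, so two crossing arcs would have to lie in the same
  half.\<close>

lemma involution_of_append:
  assumes \<pi>: "involution_of p \<pi>" and \<sigma>: "involution_of q \<sigma>"
  shows "involution_of (p @ q) (\<lambda>i. if i \<le> length p then \<pi> i else \<sigma> (i - length p) + length p)"
    (is "involution_of _ ?f")
proof -
  note P = involution_ofD[OF \<pi>] and S = involution_ofD[OF \<sigma>]
  have le: "\<pi> i \<le> length p" if "i \<le> length p" for i
    using P(2)[of i] P(3)[of i] that by (cases "i \<in> {1..length p}") auto
  have gt: "0 < \<sigma> i" if "0 < i" for i
    using S(2)[of i] S(3)[of i] that by (cases "i \<in> {1..length q}") auto
  show ?thesis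
  proof (rule involution_ofI)
    fix i
    show "?f (?f i) = i"
      using le[of i] gt[of "i - length p"] P(1) S(1) by auto
    show "?f i = i" if "i \<notin> {1..length (p @ q)}"
    proof (cases "i \<le> length p")
      case False
      then have "i - length p \<notin> {1..length q}"
        using that by auto
      then show ?thesis
        using S(2) False by simp
    qed (use that P(2)[of i] in auto)
    show "(p @ q) ! (i - 1) = (if i < ?f i then U else if ?f i < i then D else H)"
      if i: "i \<in> {1..length (p @ q)}"
    proof (cases "i \<le> length p")
      case True
      then show ?thesis
        using i P(5)[of i] by (auto simp: nth_append)
    next
      case False
      define j where "j = i - length p"
      have j: "i = j + length p" "j \<in> {1..length q}"
        using i False by (auto simp: j_def)
      have "(p @ q) ! (i - 1) = q ! (j - 1)"
        using j by (auto simp: nth_append)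
      then show ?thesis
        using S(5)[OF j(2)] j by auto
    qed
  next
    fix a c
    assume less: "a < c" "c < ?f a" "?f a < ?f c"
    show False
    proof (cases "a \<le> length p")
      case True
      then have "c \<le> length p"
        using less le[of a] by auto
      then show False
        using less True P(4)[of a "\<pi> a" c "\<pi> c"] by simp
    next
      case False
      then show False
        using less S(4)[of "a - length p" "\<sigma> (a - length p)" "c - length p" "\<sigma> (c - length p)"]
        by simp
    qed
  qed
qed

text \<open>The new arc encloses all others and hence crosses none. Index 0 has its own case since
  truncated subtraction would otherwise send it to \<open>\<sigma> 0 + 1\<close>, which is
  1.\<close>

lemma involution_of_wrap:
  assumes \<sigma>: "involution_of q \<sigma>"
  shows "involution_of (U # q @ [D])
    (\<lambda>i. if i = 0 then 0 else if i = 1 then length q + 2 else if i = length q + 2 then 1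
         else \<sigma> (i - 1) + 1)"
proof -
  define f where "f = (\<lambda>i. if i = 0 then 0 else if i = 1 then length q + 2
    else if i = length q + 2 then 1 else \<sigma> (i - 1) + 1)"
  note S = involution_ofD[OF \<sigma>]
  have f_ends: "f 1 = length q + 2" "f (length q + 2) = 1"
    by (simp_all add: f_def)
  have f_inner: "f (Suc j) = Suc (\<sigma> j)" if "j \<in> {1..length q}" for j
    using that by (simp add: f_def)
  have f_outer: "f i = i" if "i = 0 \<or> length q + 2 < i" for i
  proof (cases "i = 0")
    case False
    then have "i - 1 \<notin> {1..length q}"
      using that by auto
    then show ?thesis
      using S(2) False that by (simp add: f_def)
  qed (simp add: f_def)
  have cases: "(i = 0 \<or> length q + 2 < i) \<or> i = 1 \<or> i = length q + 2 \<or>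
      (\<exists>j\<in>{1..length q}. i = Suc j)" for i
    by (cases i) auto
  have "involution_of (U # q @ [D]) f"
  proof (rule involution_ofI)
    fix i
    consider "i = 0 \<or> length q + 2 < i" | "i = 1" | "i = length q + 2"
      | j where "j \<in> {1..length q}" "i = Suc j"
      using cases[of i] by blast
    then show "f (f i) = i"
    proof cases
      case 1
      then show ?thesis
        by (simp only: f_outer)
    next
      case (4 j)
      then show ?thesis
        using f_inner[OF 4(1)] f_inner[OF S(3)[OF 4(1)]] S(1)[of j] by simp
    qed (simp_all only: f_ends)
    show "f i = i" if "i \<notin> {1..length (U # q @ [D])}"
      by (rule f_outer) (use that in auto)
    show "(U # q @ [D]) ! (i - 1) = (if i < f i then U else if f i < i then D else H)"
      if i: "i \<in> {1..length (U # q @ [D])}"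
    proof -
      consider "i = 1" | "i = length q + 2" | j where "j \<in> {1..length q}" "i = Suc j"
        using cases[of i] i by auto
      then show ?thesis
      proof cases
        case 1
        then show ?thesis
          using f_ends by simp
      next
        case 2
        then show ?thesis
          using f_ends by (simp add: nth_append)
      next
        case (3 j)
        then obtain k where k: "j = Suc k" "k < length q"
          by (cases j) auto
        then have "(U # q @ [D]) ! (i - 1) = q ! (j - 1)"
          using 3 by (simp add: nth_append)
        then show ?thesis
          using S(5)[OF 3(1)] f_inner[OF 3(1)] 3(2) by simp
      qed
    qed
  next
    fix a c
    assume less: "a < c" "c < f a" "f a < f c"
    consider "a = 0 \<or> length q + 2 < a" | "a = 1" | "a = length q + 2"
      | j where "j \<in> {1..length q}" "a = Suc j"
      using cases[of a] by blast
    then show False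
    proof cases
      case 1
      then show False
        using less f_outer[OF 1] by simp
    next
      case 2
      then have "c - 1 \<in> {1..length q}"
        using less f_ends by auto
      then have "f c = Suc (\<sigma> (c - 1))" "\<sigma> (c - 1) \<le> length q"
        using f_inner[of "c - 1"] S(3)[of "c - 1"] less by simp_all
      then show False
        using less 2 f_ends by simp
    next
      case 3
      then show False
        using less f_ends by simp
    next
      case (4 j)
      have fa: "f a = Suc (\<sigma> j)" and "\<sigma> j \<le> length q"
        using f_inner[OF 4(1)] S(3)[OF 4(1)] 4(2) by simp_all
      then obtain k where k: "c = Suc k" "k \<in> {1..length q}"
        using less(1,2) 4 by (cases c) auto
      then show False
        using less fa 4 f_inner[OF k(2)] S(4)[of j "\<sigma> j" k "\<sigma> k"] by simp
    qed
  qed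
  then show ?thesis
    by (simp only: f_def)
qed

text \<open>The block decomposition as an induction rule: \<open>wrap\<close> builds an arc from its
  interior and \<open>append\<close> joins the blocks.\<close>

lemma motzkin_induct [consumes 1, case_names Nil H wrap append]:
  assumes "motzkin p" "P []" "P [H]"
    "\<And>q. motzkin q \<Longrightarrow> P q \<Longrightarrow> P (U # q @ [D])"
    "\<And>p q. motzkin p \<Longrightarrow> motzkin q \<Longrightarrow> P p \<Longrightarrow> P q \<Longrightarrow> P (p @ q)"
  shows "P p"
  using assms(1)
proof (induction p rule: length_induct)
  case (1 p)
  obtain bs where bs: "\<forall>b\<in>set bs. is_block b" "concat bs = p"
    using motzkin_imp_concat[OF "1.prems"] by blast
  have "P b" if b: "b \<in> set bs" for b
  proof -
    have len: "length b \<le> length p"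
      using split_list[OF b] bs(2) by auto
    have "is_block b"
      using b bs by blast
    then show ?thesis
    proof (cases rule: is_block_cases)
      case 1
      then show ?thesis
        using assms(3) by simp
    next
      case (2 q)
      then have "length q < length p"
        using len by simp
      then show ?thesis
        using assms(4)[of q] "1.IH" 2 by blast
    qed
  qed
  then have "P (concat bs)"
    using bs(1)
  proof (induction bs)
    case (Cons b bs)
    then show ?case
      using assms(5)[of b "concat bs"] is_block_motzkin motzkin_concat by simp
  qed (use assms(2) in simp)
  then show ?case
    using bs by simp
qed

text \<open>Existence comes from the explicit involutions above, one for each case of
  \<open>motzkin_induct\<close>.\<close>

lemma involution_of_path_involution:
  assumes "motzkin p"
  shows "involution_of p (path_involution p)"
proof -
  have "\<exists>\<pi>. involution_of p \<pi>"
    using assms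
    by (induction rule: motzkin_induct)
      (use involution_of_Nil involution_of_H involution_of_wrap involution_of_append in blast)+
  then show ?thesis
    using path_involution_eq by auto
qed

section \<open>One-line notation of the involution\<close>

definition path_word :: "step list \<Rightarrow> nat list" where
  "path_word p = map (path_involution p) [1..<Suc (length p)]"

lemma path_word_H: "path_word [H] = [1]"
  by (simp add: path_word_def path_involution_eq[OF involution_of_H])

lemma path_word_append:
  assumes "motzkin p" "motzkin q"
  shows "path_word (p @ q) = path_word p @ map (\<lambda>x. x + length p) (path_word q)"
  unfolding path_word_def
    path_involution_eq[OF involution_of_append[OF assms[THEN involution_of_path_involution]]]
  by (rule nth_equalityI) (auto simp: nth_append Suc_diff_le not_less simp del: upt_Suc)

lemma path_word_wrap:
  assumes "motzkin q"
  shows "path_word (U # q @ [D]) = (length q + 2) # map (\<lambda>x. x + 1) (path_word q) @ [1]"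
  unfolding path_word_def
    path_involution_eq[OF involution_of_wrap[OF assms[THEN involution_of_path_involution]]]
  by (rule nth_equalityI) (auto simp: nth_append nth_Cons' simp del: upt_Suc)

lemma set_path_word:
  assumes "motzkin p"
  shows "set (path_word p) \<subseteq> {1..length p}"
  using involution_ofD(3)[OF involution_of_path_involution[OF assms]]
  by (auto simp: path_word_def simp del: upt_Suc)

section \<open>Row insertion\<close>

lemma row_insert_bump:
  "row_insert x r = (r', Some y) \<Longrightarrow> x < y \<and> y \<in> set r \<and> length r' = length r"
  by (induction r arbitrary: r') (auto split: if_splits prod.splits)

lemma row_insert_set: "row_insert x r = (r', z) \<Longrightarrow> set r' \<subseteq> insert x (set r) \<and> r' \<noteq> []"
  by (induction r arbitrary: r') (auto split: if_splits prod.splits)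

lemma tableau_insert_set:
  "set (concat (tableau_insert x T)) \<subseteq> insert x (set (concat T))"
proof (induction T arbitrary: x)
  case (Cons r T)
  obtain r' z where rz: "row_insert x r = (r', z)"
    by force
  show ?case
  proof (cases z)
    case None
    then show ?thesis
      using rz row_insert_set[OF rz] by auto
  next
    case (Some y)
    then show ?thesis
      using rz row_insert_set[OF rz] row_insert_bump[of x r r' y] Cons[of y] by auto
  qed
qed simp

lemma fold_tableau_insert_set:
  "set (concat (fold tableau_insert w T)) \<subseteq> set w \<union> set (concat T)"
proof (induction w arbitrary: T)
  case (Cons x w)
  then show ?case
    using Cons[of "tableau_insert x T"] tableau_insert_set[of x T] by auto
qed simp

text \<open>Insertion only compares entries, so it commutes with increasing relabellings. This
  disposes of the shifts in \<open>path_word_append\<close> and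
  \<open>path_word_wrap\<close>.\<close>

lemma row_insert_map:
  assumes "strict_mono f"
  shows "row_insert (f x) (map f r) = map_prod (map f) (map_option f) (row_insert x r)"
  by (induction r) (auto simp: strict_mono_less[OF assms] split: prod.splits)

lemma tableau_insert_map:
  assumes "strict_mono f"
  shows "tableau_insert (f x) (map (map f) T) = map (map f) (tableau_insert x T)"
  by (induction T arbitrary: x)
    (auto simp: row_insert_map[OF assms] split: prod.splits option.splits)

lemma insertion_tableau_map:
  assumes "strict_mono f"
  shows "insertion_tableau (map f w) = map (map f) (insertion_tableau w)"
proof -
  have "fold tableau_insert (map f w) (map (map f) T) = map (map f) (fold tableau_insert w T)" for T
    by (induction w arbitrary: T) (auto simp: tableau_insert_map[OF assms])
  from this[of "[]"] show ?thesis
    by (simp add: insertion_tableau_def)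
qed

lemma shape_map [simp]: "shape (map (map f) T) = shape T"
  by (simp add: shape_def)

section \<open>Tableaux placed side by side\<close>

fun beside :: "nat list list \<Rightarrow> nat list list \<Rightarrow> nat list list" where
  "beside [] T = T"
| "beside S [] = S"
| "beside (r # S) (s # T) = (r @ s) # beside S T"

text \<open>The sum of two partitions, the shorter one being continued by zeros.\<close>

fun padded_sum :: "nat list \<Rightarrow> nat list \<Rightarrow> nat list" where
  "padded_sum [] ys = ys"
| "padded_sum xs [] = xs"
| "padded_sum (x # xs) (y # ys) = (x + y) # padded_sum xs ys"

lemma beside_Nil [simp]: "beside S [] = S"
  by (cases S) auto

lemma padded_sum_Nil [simp]: "padded_sum xs [] = xs"
  by (cases xs) auto

lemma shape_beside: "shape (beside S T) = padded_sum (shape S) (shape T)"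
  by (induction S T rule: beside.induct) (auto simp: shape_def)

lemma length_padded_sum [simp]: "length (padded_sum xs ys) = max (length xs) (length ys)"
  by (induction xs ys rule: padded_sum.induct) auto

text \<open>Rows below the shorter summand are not affected by it. With the left version, this pulls
  the rows contributed by arcs out of a sum.\<close>

lemma padded_sum_append_right:
  "length xs \<le> length ys \<Longrightarrow> padded_sum xs (ys @ zs) = padded_sum xs ys @ zs"
  by (induction xs ys rule: padded_sum.induct) auto

lemma padded_sum_append_left:
  "length ys \<le> length xs \<Longrightarrow> padded_sum (xs @ zs) ys = padded_sum xs ys @ zs"
  by (induction xs ys rule: padded_sum.induct) auto

lemma row_insert_append:
  "\<forall>y\<in>set r. y \<le> x \<Longrightarrow> row_insert x (r @ s) = map_prod ((@) r) id (row_insert x s)"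
  by (induction r) (auto simp: map_prod_def split: prod.splits)

text \<open>A letter at least as large as all of \<open>S\<close> passes over the \<open>S\<close>
  part of the first row. The letter it bumps is larger still, so the same happens in the next
  row.\<close>

lemma tableau_insert_beside:
  "\<forall>y\<in>set (concat S). y \<le> x \<Longrightarrow> tableau_insert x (beside S T) = beside S (tableau_insert x T)"
proof (induction S T arbitrary: x rule: beside.induct)
  case (2 r S)
  then show ?case
    using row_insert_append[of r x "[]"] by simp
next
  case (3 r S s T)
  have row: "row_insert x (r @ s) = map_prod ((@) r) id (row_insert x s)"
    using 3 by (intro row_insert_append) auto
  obtain s' z where sz: "row_insert x s = (s', z)"
    by force
  show ?case
  proof (cases z)
    case None
    then show ?thesis
      using sz row by simp
  next
    case (Some y)
    then have "x < y"
      using sz row_insert_bump by blast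
    moreover have "\<forall>u\<in>set (concat S). u \<le> x"
      using 3(2) by auto
    ultimately have "\<forall>u\<in>set (concat S). u \<le> y"
      by (meson less_imp_le order.trans)
    then show ?thesis
      using 3(1)[of y] sz row Some by simp
  qed
qed simp

lemma insertion_tableau_append:
  assumes "\<And>x y. x \<in> set v \<Longrightarrow> y \<in> set w \<Longrightarrow> x \<le> y"
  shows "insertion_tableau (v @ w) = beside (insertion_tableau v) (insertion_tableau w)"
proof -
  let ?S = "insertion_tableau v"
  have S: "set (concat ?S) \<subseteq> set v"
    using fold_tableau_insert_set[of v "[]"] by (simp add: insertion_tableau_def)
  \<comment> \<open>Generalised over the right-hand tableau \<open>T\<close>, which grows with each
    letter of \<open>w\<close>; it starts empty.\<close>
  have "fold tableau_insert w (beside ?S T) = beside ?S (fold tableau_insert w T)" for T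
    using assms
  proof (induction w arbitrary: T)
    case (Cons x w)
    have "tableau_insert x (beside ?S T) = beside ?S (tableau_insert x T)"
      by (rule tableau_insert_beside) (use S Cons.prems in fastforce)
    then show ?case
      using Cons by simp
  qed simp
  from this[of "[]"] show ?thesis
    by (simp add: insertion_tableau_def)
qed

text \<open>If bumping runs out of \<open>T\<close>, the last bumped letter pushes \<open>m\<close>
  into a new bottom row; in \<open>T\<close> alone it would have opened that row itself.\<close>

lemma tableau_insert_snoc_max:
  assumes "x < m" "\<forall>y\<in>set (concat T). y < m"
  shows "tableau_insert x (T @ [[m]]) = tableau_insert x T @ [[m]]"
  using assms
proof (induction T arbitrary: x)
  case (Cons r T)
  obtain r' z where rz: "row_insert x r = (r', z)"
    by force
  show ?case
  proof (cases z)
    case (Some y)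
    then have "y < m"
      using rz row_insert_bump[of x r r' y] Cons.prems by auto
    then show ?thesis
      using Cons.IH[of y] Cons.prems rz Some by simp
  qed (use rz in simp)
qed simp

lemma insertion_tableau_Cons_max:
  assumes "\<forall>x\<in>set w. x < m"
  shows "insertion_tableau (m # w) = insertion_tableau w @ [[m]]"
proof -
  have "fold tableau_insert w (T @ [[m]]) = fold tableau_insert w T @ [[m]]"
    if "\<forall>y\<in>set (concat T). y < m" for T
    using that assms
  proof (induction w arbitrary: T)
    case (Cons x w)
    have "\<forall>y\<in>set (concat (tableau_insert x T)). y < m"
      using tableau_insert_set[of x T] Cons.prems by auto
    then show ?case
      using Cons tableau_insert_snoc_max[of x m T] by simp
  qed simp
  from this[of "[]"] show ?thesis
    by (simp add: insertion_tableau_def)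
qed

section \<open>Strict increase down the first column\<close>

definition strict_heads :: "nat list list \<Rightarrow> bool" where
  "strict_heads T \<longleftrightarrow> [] \<notin> set T \<and> sorted_wrt (<) (map hd T)"

lemma strict_heads_Cons:
  "strict_heads (r # T) \<longleftrightarrow> r \<noteq> [] \<and> strict_heads T \<and> (T \<noteq> [] \<longrightarrow> hd r < hd (hd T))"
  by (cases T) (auto simp: strict_heads_def)

lemma row_insert_hd: "row_insert x r = (r', z) \<Longrightarrow> r \<noteq> [] \<Longrightarrow> hd r' = min x (hd r)"
  by (cases r) (auto split: if_splits prod.splits)

lemma tableau_insert_hd:
  assumes "strict_heads T"
  shows "tableau_insert x T \<noteq> [] \<and>
    hd (hd (tableau_insert x T)) = (if T = [] then x else min x (hd (hd T)))"
proof (cases T)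
  case (Cons r T')
  obtain r' z where rz: "row_insert x r = (r', z)"
    by force
  then show ?thesis
    using row_insert_hd[OF rz] assms Cons
    by (auto simp: strict_heads_Cons split: option.splits)
qed simp

lemma row_insert_bump_head:
  "row_insert x r = (r', Some y) \<Longrightarrow> hd r' < y"
  by (cases r) (auto dest: row_insert_bump split: if_splits prod.splits)

text \<open>The head of a row never increases, and a bumped letter exceeds the new head of the row
  it leaves; hence it may become the head of the next row.\<close>

lemma strict_heads_tableau_insert:
  "strict_heads T \<Longrightarrow> strict_heads (tableau_insert x T)"
proof (induction T arbitrary: x)
  case Nil
  then show ?case
    by (simp add: strict_heads_def)
next
  case (Cons r T)
  obtain r' z where rz: "row_insert x r = (r', z)"
    by force
  have r: "r \<noteq> []" "strict_heads T" "T \<noteq> [] \<Longrightarrow> hd r < hd (hd T)"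
    using Cons.prems by (auto simp: strict_heads_Cons)
  have r': "r' \<noteq> []" "hd r' \<le> hd r"
    using row_insert_set[OF rz] row_insert_hd[OF rz] r by auto
  show ?case
  proof (cases z)
    case None
    then show ?thesis
      using rz r r' by (auto simp: strict_heads_Cons)
  next
    case (Some y)
    then have "hd r' < y"
      using rz row_insert_bump_head by simp
    then show ?thesis
      using rz Some r r' Cons.IH[of y] tableau_insert_hd[of T y]
      by (auto simp: strict_heads_Cons)
  qed
qed

lemma strict_heads_insertion_tableau: "strict_heads (insertion_tableau w)"
proof -
  have "strict_heads T \<Longrightarrow> strict_heads (fold tableau_insert w T)" for T
    by (induction w arbitrary: T) (auto simp: strict_heads_tableau_insert)
  then show ?thesis
    by (simp add: insertion_tableau_def strict_heads_def)
qed

text \<open>Inserting a new minimum pushes the whole first column down by one.\<close>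

lemma shape_tableau_insert_min:
  assumes "strict_heads T" "T \<noteq> [] \<Longrightarrow> x < hd (hd T)"
  shows "shape (tableau_insert x T) = shape T @ [1]"
  using assms
proof (induction T arbitrary: x)
  case (Cons r T)
  then obtain y ys where "r = y # ys" "x < y"
    by (cases r) (auto simp: strict_heads_Cons)
  then show ?case
    using Cons by (auto simp: strict_heads_Cons shape_def)
qed (simp add: shape_def)

section \<open>The shape of the Richardson tableau of a path\<close>

definition path_shape :: "step list \<Rightarrow> nat list" where
  "path_shape p = shape (richardson_tableau p)"

lemma path_shape_word: "path_shape p = shape (insertion_tableau (path_word p))"
  by (simp add: path_shape_def richardson_tableau_def path_word_def)

lemma path_shape_Nil [simp]: "path_shape [] = []"
  by (simp add: path_shape_word path_word_def insertion_tableau_def shape_def)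

lemma path_shape_H [simp]: "path_shape [H] = [1]"
  by (simp add: path_shape_word path_word_H insertion_tableau_def shape_def)

lemma strict_mono_add_nat: "strict_mono (\<lambda>x::nat. x + c)"
  by (simp add: strict_mono_def)

lemma path_shape_append:
  assumes "motzkin p" "motzkin q"
  shows "path_shape (p @ q) = padded_sum (path_shape p) (path_shape q)"
proof -
  let ?w = "map (\<lambda>x. x + length p) (path_word q)"
  have "insertion_tableau (path_word p @ ?w)
      = beside (insertion_tableau (path_word p)) (insertion_tableau ?w)"
    by (rule insertion_tableau_append) (use set_path_word[OF assms(1)] in fastforce)
  then show ?thesis
    by (simp add: path_shape_word path_word_append[OF assms] shape_beside
        insertion_tableau_map[OF strict_mono_add_nat])
qed

text \<open>Each end of the arc adds one row: the leading maximum remains a bottom row of its own,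
  and the final minimum pushes the first column down once more.\<close>

lemma path_shape_wrap:
  assumes "motzkin q"
  shows "path_shape (U # q @ [D]) = path_shape q @ [1, 1]"
proof -
  let ?w = "map (\<lambda>x. x + 1) (path_word q)"
  let ?m = "length q + 2"
  let ?T = "insertion_tableau (?m # ?w)"
  have w: "set ?w \<subseteq> {2..<?m}"
    using set_path_word[OF assms] by fastforce
  have T: "?T = insertion_tableau ?w @ [[?m]]"
    by (rule insertion_tableau_Cons_max) (use w in auto)
  \<comment> \<open>The top left entry is one of the letters inserted so far, all of which are at
    least 2.\<close>
  have "1 < hd (hd ?T)" if "?T \<noteq> []"
  proof -
    have "hd ?T \<noteq> []"
      using strict_heads_insertion_tableau[of "?m # ?w"] that
      by (metis strict_heads_Cons list.collapse)
    then have "hd (hd ?T) \<in> set (concat ?T)"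
      using hd_in_set[OF that] hd_in_set[of "hd ?T"] unfolding set_concat by blast
    then have "hd (hd ?T) \<in> set (?m # ?w)"
      using fold_tableau_insert_set[of "?m # ?w" "[]"] unfolding insertion_tableau_def by auto
    then show ?thesis
      using w by auto
  qed
  then have "shape (tableau_insert 1 ?T) = shape ?T @ [1]"
    by (rule shape_tableau_insert_min[OF strict_heads_insertion_tableau])
  moreover have "insertion_tableau (path_word (U # q @ [D])) = tableau_insert 1 ?T"
    unfolding path_word_wrap[OF assms] by (simp add: insertion_tableau_def)
  moreover have "shape ?T = path_shape q @ [1]"
    unfolding T insertion_tableau_map[OF strict_mono_add_nat]
    by (simp add: path_shape_word shape_def)
  ultimately show ?thesis
    by (simp add: path_shape_word)
qed

lemma path_shape_wraps:
  assumes "motzkin q"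
  shows "path_shape (replicate m U @ q @ replicate m D) = path_shape q @ replicate (2 * m) 1"
proof (induction m)
  case (Suc m)
  have eq: "replicate (Suc m) U @ q @ replicate (Suc m) D
      = U # (replicate m U @ q @ replicate m D) @ [D]"
    by (simp add: replicate_append_same)
  show ?case
    unfolding eq path_shape_wrap[OF motzkin_wraps[OF assms]] Suc
    by (simp add: replicate_app_Cons_same)
qed simp

section \<open>The number of rows is twice the height\<close>

text \<open>Twice \<open>ht\<close>, by recursion on the steps and in integers. The 0 or 1 stands
  for the starting point, which counts one half more if an \<open>H\<close> leaves it.\<close>

fun double_ht :: "step list \<Rightarrow> int" where
  "double_ht [] = 0"
| "double_ht (s # p) = max (if s = H then 1 else 0) (2 * rise s + double_ht p)"

lemma double_ht_nonneg: "0 \<le> double_ht p"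
  by (cases p) auto

lemma double_ht_append: "double_ht (p @ q) = max (double_ht p) (2 * height p + double_ht q)"
proof (induction p)
  case Nil
  then show ?case
    using double_ht_nonneg[of q] by simp
qed (auto simp: max_def)

text \<open>Together with \<open>double_ht_attained\<close>, this describes \<open>double_ht\<close>
  as a maximum over the points of the path.\<close>

lemma double_ht_ge:
  "k \<le> length p \<Longrightarrow> 2 * height (take k p) + (if k < length p \<and> p ! k = H then 1 else 0) \<le> double_ht p"
proof (induction p arbitrary: k)
  case (Cons s p)
  show ?case
  proof (cases k)
    case 0
    then show ?thesis
      by auto
  next
    case (Suc j)
    then show ?thesis
      using Cons.IH[of j] Cons.prems by (auto simp: max_def)
  qed
qed simp

lemma double_ht_attained:
  "\<exists>k\<le>length p. double_ht p = 2 * height (take k p) + (if k < length p \<and> p ! k = H then 1 else 0)"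
proof (induction p)
  case (Cons s p)
  then obtain k where k: "k \<le> length p"
    "double_ht p = 2 * height (take k p) + (if k < length p \<and> p ! k = H then 1 else 0)"
    by blast
  show ?case
  proof (cases "(if s = H then 1 else 0) \<le> 2 * rise s + double_ht p")
    case True
    then show ?thesis
      using k by (intro exI[of _ "Suc k"]) auto
  next
    case False
    then show ?thesis
      by (intro exI[of _ 0]) auto
  qed
qed simp

text \<open>A level weighs two and an \<open>H\<close> step one, so lower levels never win. Thus
  \<open>double_ht p\<close> is \<open>2 * max_height p\<close>, or one more exactly if some
  \<open>H\<close> lies at the maximal height.\<close>

lemma double_ht: "2 * ht p = of_int (double_ht p)"
proof -
  let ?h = "\<lambda>k. height (take k p)"
  let ?f = "\<lambda>k. if k < length p \<and> p ! k = H then 1 else (0::int)"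
  have fin: "finite (?h ` {0..length p})"
    by simp
  have le: "?h k \<le> max_height p" if "k \<le> length p" for k
    unfolding max_height_def using fin that by (intro Max_ge) auto
  have "max_height p \<in> ?h ` {0..length p}"
    unfolding max_height_def using fin by (intro Max_in) auto
  then obtain m where m: "m \<le> length p" "max_height p = ?h m"
    by auto
  obtain k where k: "k \<le> length p" "double_ht p = 2 * ?h k + ?f k"
    using double_ht_attained by blast
  have upper: "double_ht p \<le> 2 * max_height p + 1"
    using k le[of k] by (auto split: if_splits)
  have lower: "2 * max_height p \<le> double_ht p"
    using double_ht_ge[OF m(1)] m(2) by (auto split: if_splits)
  show ?thesis
  proof (cases "\<exists>k<length p. p ! k = H \<and> ?h k = max_height p")
    case True
    then obtain i where "i < length p" "p ! i = H" "?h i = max_height p"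
      by blast
    then have "double_ht p = 2 * max_height p + 1"
      using upper double_ht_ge[of i p] by simp
    then show ?thesis
      using True by (simp add: ht_def)
  next
    case False
    then have "double_ht p \<noteq> 2 * max_height p + 1"
      using k le[of k] by (auto split: if_splits)
    then have "double_ht p = 2 * max_height p"
      using upper lower by simp
    then show ?thesis
      using False by (simp add: ht_def)
  qed
qed

text \<open>Both sides obey the same recursion: an arc adds two, and concatenation takes the maximum
  because Motzkin paths end at level 0.\<close>

lemma length_path_shape:
  assumes "motzkin p"
  shows "int (length (path_shape p)) = double_ht p"
  using assms
proof (induction rule: motzkin_induct)
  case (wrap q)
  then show ?case
    using double_ht_nonneg[of q]
    by (simp add: path_shape_wrap[simplified] double_ht_append motzkin_def)
next
  case (append p q)
  then show ?case
    by (simp add: path_shape_append double_ht_append motzkin_def of_nat_max)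
qed simp_all

text \<open>Translates the criterion by which the algorithm selects a block into the comparison of
  row numbers that \<open>padded_sum_append_left\<close> and \<open>padded_sum_append_right\<close>
  ask for.\<close>

lemma ht_le_iff:
  assumes "motzkin p" "motzkin q"
  shows "ht p \<le> ht q \<longleftrightarrow> length (path_shape p) \<le> length (path_shape q)"
proof -
  have "ht p \<le> ht q \<longleftrightarrow> 2 * ht p \<le> 2 * ht q"
    by simp
  also have "\<dots> \<longleftrightarrow> double_ht p \<le> double_ht q"
    unfolding double_ht by (rule of_int_le_iff)
  also have "\<dots> \<longleftrightarrow> length (path_shape p) \<le> length (path_shape q)"
    unfolding assms[THEN length_path_shape, symmetric] by (rule of_nat_le_iff)
  finally show ?thesis .
qed

section \<open>The shape algorithm\<close>

lemma length_path_shape_concat_le: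
  assumes "\<forall>b\<in>set bs. is_block b \<and> length (path_shape b) \<le> n"
  shows "length (path_shape (concat bs)) \<le> n"
  using assms
  by (induction bs) (auto simp: path_shape_append is_block_motzkin motzkin_concat)

lemma is_block_wraps:
  assumes "is_block q"
  shows "is_block (replicate m U @ q @ replicate m D)"
proof (cases m)
  case (Suc k)
  have "replicate m U @ q @ replicate m D
      = U # (replicate k U @ q @ replicate k D) @ [D]"
    by (simp add: Suc replicate_append_same)
  then show ?thesis
    using is_block_wrap motzkin_wraps is_block_motzkin assms by presburger
qed (use assms in simp)

text \<open>
  Wrapping a path in \<open>m\<close> arcs appends \<open>2 * m\<close> rows of length one to its shape. This commutes
  with adding the shapes of the other blocks because \<open>q\<close> already has the most rows.
\<close>

lemma path_shape_move_arcs: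
  assumes bs: "\<forall>b\<in>set bs. is_block b \<and> ht b \<le> ht q"
    and cs: "\<forall>b\<in>set cs. is_block b \<and> ht b \<le> ht q"
    and q: "is_block q"
  shows "path_shape (concat bs @ replicate m U @ q @ replicate m D @ concat cs)
    = path_shape (replicate m U @ (concat bs @ q @ concat cs) @ replicate m D)"
proof -
  let ?n = "length (path_shape q)" and ?r = "replicate (2 * m) 1"
  let ?q = "replicate m U @ q @ replicate m D"
  have mq: "motzkin q" and mbs: "motzkin (concat bs)" and mcs: "motzkin (concat cs)"
    using assms by (auto intro: is_block_motzkin motzkin_concat)
  have mw: "motzkin ?q"
    using motzkin_wraps[OF mq] .
  have le: "length (path_shape (concat bs)) \<le> ?n" "length (path_shape (concat cs)) \<le> ?n"
    using bs cs ht_le_iff[OF _ mq] is_block_motzkin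
    by (auto intro!: length_path_shape_concat_le)
  have "path_shape (concat bs @ ?q @ concat cs)
      = padded_sum (path_shape (concat bs)) (padded_sum (path_shape q @ ?r) (path_shape (concat cs)))"
    by (simp only: path_shape_append mbs mw mcs motzkin_append path_shape_wraps mq)
  also have "\<dots> = padded_sum (path_shape (concat bs))
      (padded_sum (path_shape q) (path_shape (concat cs))) @ ?r"
    using le by (simp add: padded_sum_append_left padded_sum_append_right)
  also have "\<dots> = path_shape (concat bs @ q @ concat cs) @ ?r"
    by (simp only: path_shape_append mbs mq mcs motzkin_append)
  also have "\<dots> = path_shape (replicate m U @ (concat bs @ q @ concat cs) @ replicate m D)"
    by (rule path_shape_wraps[symmetric]) (intro motzkin_append mbs mq mcs)
  finally show ?thesis
    by simp
qed

lemma is_unit_path_even: "0 < m \<Longrightarrow> is_unit_path (replicate m U @ replicate m D)"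
  unfolding is_unit_path_def by (rule exI[of _ "2 * m"]) (simp add: unit_path_def)

lemma is_unit_path_odd: "is_unit_path (replicate m U @ [H] @ replicate m D)"
  unfolding is_unit_path_def by (rule exI[of _ "2 * m + 1"]) (simp add: unit_path_def)

text \<open>A non-unit block has at least two inner blocks below its \<open>M\<close> outer arcs.
  None would give an even unit path; a single one would be \<open>[H]\<close>, giving an odd unit
  path, or an arc, contradicting the maximality of \<open>M\<close>.\<close>

lemma block_step_properties:
  assumes b: "is_block b" and nonunit: "\<not> is_unit_path b"
  obtains cs where "\<forall>c\<in>set cs. is_block c" "2 \<le> length cs" "block_step b = concat cs"
    "length (block_step b) = length b" "path_shape (block_step b) = path_shape b"
proof -
  let ?dec = "\<lambda>m qs. (\<forall>q\<in>set qs. is_block q) \<and> b = replicate m U @ concat qs @ replicate m D"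
  let ?Q = "\<lambda>m. \<exists>qs. ?dec m qs"
  define M where "M = (GREATEST m. ?Q m)"
  \<comment> \<open>\<open>GREATEST\<close> is meaningful here: some \<open>m\<close> qualifies,
    namely 0 with \<open>[b]\<close>, and \<open>length b\<close> bounds them all.\<close>
  have bound: "m \<le> length b" if "?Q m" for m
    using that by auto
  have "?dec 0 [b]"
    using b by simp
  then have "?Q 0"
    by blast
  then have QM: "?Q M" and maximal: "m \<le> M" if "?Q m" for m
    unfolding M_def using GreatestI_nat[of ?Q 0 "length b"] Greatest_le_nat[of ?Q m "length b"]
      bound that by blast+
  obtain qs where qs: "?dec M qs"
    using QM[OF \<open>?Q 0\<close>] by blast
  have the_qs: "(THE qs. ?dec M qs) = qs"
  proof (rule the_equality)
    show "?dec M qs"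
      by (rule qs)
    show "rs = qs" if "?dec M rs" for rs
      using that qs by (intro concat_blocks_inject) auto
  qed
  have two: "2 \<le> length qs"
  proof (rule ccontr)
    assume "\<not> ?thesis"
    then consider "qs = []" | q where "qs = [q]"
      by (cases qs; cases "tl qs") auto
    then show False
    proof cases
      case 1
      then have "0 < M"
        using qs b by (cases M) auto
      then show False
        using is_unit_path_even 1 qs nonunit by auto
    next
      case (2 q)
      then have "is_block q"
        using qs by simp
      then show False
      proof (cases rule: is_block_cases)
        case 1
        then show False
          using is_unit_path_odd[of M] 2 qs nonunit by simp
      next
        case inner: (2 r)
        then obtain rs where rs: "\<forall>q\<in>set rs. is_block q" "concat rs = r"
          using motzkin_imp_concat by blast
        \<comment> \<open>The single inner arc can be stripped as well, one level beyond
          \<open>M\<close>.\<close>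
        have "b = replicate (Suc M) U @ concat rs @ replicate (Suc M) D"
          using qs 2 inner rs by (simp add: replicate_app_Cons_same)
        then show False
          using maximal[of "Suc M"] rs by auto
      qed
    qed
  qed
  let ?T = "\<lambda>t. t < length qs \<and> (\<forall>j<length qs. ht (qs ! j) \<le> ht (qs ! t))"
  define t where "t = (LEAST t. ?T t)"
  have "\<exists>t. ?T t"
  proof -
    have fin: "finite ((\<lambda>j. ht (qs ! j)) ` {..<length qs})"
      by simp
    have "Max ((\<lambda>j. ht (qs ! j)) ` {..<length qs}) \<in> (\<lambda>j. ht (qs ! j)) ` {..<length qs}"
      using fin two by (intro Max_in) (auto simp: lessThan_empty_iff)
    then obtain t where "t < length qs" "Max ((\<lambda>j. ht (qs ! j)) ` {..<length qs}) = ht (qs ! t)"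
      by auto
    then show ?thesis
      using Max_ge[OF fin] by fastforce
  qed
  then have t: "?T t"
    unfolding t_def by (rule LeastI_ex)
  let ?w = "replicate M U @ qs ! t @ replicate M D"
  \<comment> \<open>The selected block stays a single block under the moved arcs, so there are as
    many blocks as in \<open>qs\<close>.\<close>
  let ?cs = "take t qs @ ?w # drop (Suc t) qs"
  have step: "block_step b = concat (take t qs) @ replicate M U @ qs ! t @ replicate M D
      @ concat (drop (Suc t) qs)"
    unfolding block_step_def M_def[symmetric] Let_def the_qs t_def[symmetric] by simp
  have bq: "is_block (qs ! t)"
    using qs t by simp
  have highest: "ht q \<le> ht (qs ! t)" if "q \<in> set qs" for q
    using that t by (metis in_set_conv_nth)
  have concat_qs: "concat qs = concat (take t qs) @ qs ! t @ concat (drop (Suc t) qs)"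
  proof -
    have "qs = take t qs @ qs ! t # drop (Suc t) qs"
      using t by (simp add: id_take_nth_drop)
    then show ?thesis
      by (metis concat.simps(2) concat_append)
  qed
  show thesis
  proof (rule that)
    show "\<forall>c\<in>set ?cs. is_block c"
      using qs is_block_wraps[OF bq] by (auto dest: in_set_takeD in_set_dropD)
    show "2 \<le> length ?cs"
      using two t by simp
    show "block_step b = concat ?cs"
      by (simp add: step)
    have b_eq: "b = replicate M U
        @ (concat (take t qs) @ qs ! t @ concat (drop (Suc t) qs)) @ replicate M D"
      using qs concat_qs by metis
    show "length (block_step b) = length b"
      using arg_cong[OF b_eq, of length] by (simp add: step)
    show "path_shape (block_step b) = path_shape b"
      unfolding step
      \<comment> \<open>Folding \<open>b_eq\<close> recognises the right-hand side, with the arcs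
        around all inner blocks, as \<open>b\<close>.\<close>
      by (rule path_shape_move_arcs[where bs = "take t qs" and q = "qs ! t"
            and cs = "drop (Suc t) qs" and m = M, folded b_eq])
        (use qs bq highest in \<open>auto dest: in_set_takeD in_set_dropD\<close>)
  qed
qed

text \<open>Only one block changes, and shapes, lengths and block lists are all assembled from those
  of the pieces.\<close>

lemma shape_step_properties:
  assumes p: "motzkin p" and "\<not> all_unit p"
  shows "motzkin (shape_step p)" "path_shape (shape_step p) = path_shape p"
    "length (shape_step p) = length p" "length (blocks p) < length (blocks (shape_step p))"
proof -
  let ?bs = "blocks p"
  let ?I = "\<lambda>i. i < length ?bs \<and> \<not> is_unit_path (?bs ! i)"
  define i where "i = (LEAST i. ?I i)"
  have "\<exists>i. ?I i"
    using assms(2) unfolding all_unit_def by (metis in_set_conv_nth)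
  then have i: "?I i"
    unfolding i_def by (rule LeastI_ex)
  note bs = motzkin_blocks[OF p]
  let ?l = "take i ?bs" and ?b = "?bs ! i" and ?r = "drop (Suc i) ?bs"
  have b: "is_block ?b"
    using bs i by simp
  obtain cs where cs: "\<forall>c\<in>set cs. is_block c" "2 \<le> length cs" "block_step ?b = concat cs"
    "length (block_step ?b) = length ?b" "path_shape (block_step ?b) = path_shape ?b"
    using block_step_properties[OF b] i by blast
  have step: "shape_step p = concat ?l @ concat cs @ concat ?r"
    unfolding shape_step_def Let_def i_def[symmetric] cs by simp
  have bs_eq: "?bs = ?l @ ?b # ?r"
    using i by (simp add: id_take_nth_drop)
  have p_eq: "p = concat ?l @ ?b @ concat ?r"
    using bs(2) bs_eq by (metis concat.simps(2) concat_append)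
  have l: "\<forall>b\<in>set ?l. is_block b" and r: "\<forall>b\<in>set ?r. is_block b"
    using bs(1) by (auto dest: in_set_takeD in_set_dropD)
  note m = motzkin_concat[OF l] motzkin_concat[OF r] motzkin_concat[OF cs(1)]
    is_block_motzkin[OF b]
  show "motzkin (shape_step p)"
    unfolding step by (intro motzkin_append m)
  have "path_shape (concat ?l @ concat cs @ concat ?r) = path_shape (concat ?l @ ?b @ concat ?r)"
    using cs by (simp only: path_shape_append m motzkin_append)
  then show "path_shape (shape_step p) = path_shape p"
    using step p_eq by simp
  show "length (shape_step p) = length p"
    using cs arg_cong[OF p_eq, of length] by (simp add: step)
  \<comment> \<open>By uniqueness of the decomposition, the new block list is the old one with
    \<open>?b\<close> replaced by \<open>cs\<close>.\<close>
  have "blocks (shape_step p) = ?l @ cs @ ?r"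
    using blocks_concat[of "?l @ cs @ ?r"] l r cs(1) by (auto simp: step)
  then show "length (blocks p) < length (blocks (shape_step p))"
    using cs(2) i by simp
qed

text \<open>The path shape is a loop invariant, and the loop ends because the length is constant
  while the number of blocks grows.\<close>

lemma path_shape_p_min:
  assumes "motzkin p"
  shows "path_shape (p_min p) = path_shape p"
  unfolding p_min_def
proof (rule while_rule[where P = "\<lambda>q. motzkin q \<and> path_shape q = path_shape p"
      and r = "measure (\<lambda>q. length q - length (blocks q))"])
  fix q
  assume q: "motzkin q \<and> path_shape q = path_shape p" "\<not> all_unit q"
  note s = shape_step_properties[of q]
  show "motzkin (shape_step q) \<and> path_shape (shape_step q) = path_shape p"
    using s q by simp
  \<comment> \<open>Without this bound, truncated subtraction could keep the measure at 0.\<close>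
  have "length (blocks (shape_step q)) \<le> length (shape_step q)"
    using length_blocks_le motzkin_blocks[of "shape_step q"] s q by metis
  then show "(shape_step q, q) \<in> measure (\<lambda>q. length q - length (blocks q))"
    using s q by simp
qed (use assms in auto)

theorem lemma3p4:
  fixes n :: nat and p :: "step list"
  assumes "p \<in> motzkin_paths n"
  shows "shape (richardson_tableau p) = shape (richardson_tableau (p_min p))"
proof -
  have "motzkin p"
    using assms by (auto simp: motzkin_iff motzkin_paths_def)
  then show ?thesis
    using path_shape_p_min by (simp add: path_shape_def)
qed

end
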